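(* For almost all $x\in(0,1)$ (Lebesgue measure), with infinite continued fraction expansion $x=[a_1,a_2,\ldots]$, $$\limsup_{n\to\infty}\frac{\log a_n}{\log n}=1.$$
   Context: For irrational $x\in(0,1)$, $x=[a_1,a_2,\ldots]=\cfrac{1}{a_1+\cfrac{1}{a_2+\cfrac{1}{a_3+\cdots}}}$ denotes the unique infinite regular continued fraction expansion, with positive integers $a_i$ (the partial quotients). *)

theory Defs
  imports "HOL-Analysis.Analysis"
begin

primrec finite_cf :: "nat list \<Rightarrow> real" where
  "finite_cf [] = 0"
| "finite_cf (a # as) = 1 / (real a + finite_cf as)"

(* The sequence is indexed from 1, as in x = [a_1, a_2, ...]. The unused entry a 0 is the
   integer part of x, which is 0 on (0,1); fixing it makes the sequence unique. *)
definition cf_expansion :: "real \<Rightarrow> (nat \<Rightarrow> nat) \<Rightarrow> bool" where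
  "cf_expansion x a \<longleftrightarrow>
     a 0 = 0 \<and> (\<forall>i\<ge>1. a i > 0) \<and> (\<lambda>n. finite_cf (map a [1..<Suc n])) \<longlonglongrightarrow> x"

(* Meaningful for irrational x in (0,1), where the infinite expansion exists and is unique. *)
definition partial_quotient :: "real \<Rightarrow> nat \<Rightarrow> nat" where
  "partial_quotient x = (THE a. cf_expansion x a)"

end

theory Submission
  imports Defs "HOL-Real_Asymp.Real_Asymp"
begin

text \<open>
  The theorem follows from the Borel--Bernstein dichotomy for the two sequences needed here. The
  sum of \<open>1 / n powr p\<close> converges for every \<open>p > 1\<close>, so almost surely \<open>a\<^sub>n < n powr p\<close> from some
  point on and the upper limit is at most \<open>p\<close>; the sum of \<open>1 / n\<close> diverges, so almost surely
  \<open>a\<^sub>n \<ge> n\<close> infinitely often and the upper limit is at least \<open>1\<close>.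

  On irrational points the partial quotients are read off the Gauss map \<open>T t = frac (1 / t)\<close>: the
  next digit of \<open>t\<close> is the integer part of \<open>1 / t\<close>
  (\<open>partial_quotient_eq_digit\<close>). The digits are not independent under Lebesgue measure, but their
  dependence is controlled by a one-parameter family of probability measures \<open>M s\<close> on the unit
  interval, \<open>0 \<le> s \<le> 1\<close>, with density \<open>(1 + s) / (1 + s * t)\<^sup>2\<close>. The measure \<open>M 0\<close> is Lebesgue
  measure, and under \<open>M s\<close>, given that the first digit is \<open>a\<close>, the point \<open>T t\<close> has law
  \<open>M (1 / (a + s))\<close> (\<open>emeasure_first_digit_gauss_map\<close>). A bound on \<open>M s B\<close> that is uniform in \<open>s\<close>
  therefore still holds after conditioning on the first digit
  (\<open>emeasure_first_digit_gauss_map_le\<close>), and by iteration after conditioning on any past digits.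

  The distribution of the first digit is explicit: \<open>M s {t. k \<le> first digit} = (1 + s) / (k + s)\<close>,
  which lies between \<open>1 / k\<close> and \<open>2 / k\<close>. The upper bound makes the events \<open>a\<^sub>n \<ge> n powr p\<close>
  summable, and the first Borel--Cantelli lemma applies. The lower bound says that each digit stays
  below its threshold \<open>k\<close> with conditional probability at most \<open>1 - 1 / k\<close>; with the \<open>N\<close>
  thresholds \<open>m + 1, \<dots>, m + N\<close> these factors telescope to \<open>m / (m + N)\<close>
  (\<open>emeasure_digits_below_diagonal\<close>), which tends to \<open>0\<close> as \<open>N\<close> grows. This takes
  the place of the second Borel--Cantelli lemma, whose independence hypothesis fails.
\<close>

section \<open>The Gauss map and continued fraction expansions\<close>

definition first_digit :: "real \<Rightarrow> nat" where
  "first_digit t = nat \<lfloor>1 / t\<rfloor>"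

definition gauss_map :: "real \<Rightarrow> real" where
  "gauss_map t = frac (1 / t)"

text \<open>Counting starts at \<open>0\<close>, so \<open>digit n x\<close> is the classical partial quotient \<open>a\<^sub>n\<^sub>+\<^sub>1\<close>.\<close>

definition digit :: "nat \<Rightarrow> real \<Rightarrow> nat" where
  "digit n t = first_digit ((gauss_map ^^ n) t)"

lemma digit_0 [simp]: "digit 0 t = first_digit t"
  by (simp add: digit_def)

lemma digit_Suc: "digit (Suc n) t = digit n (gauss_map t)"
  by (simp add: digit_def funpow_swap1)

definition irrational_unit :: "real set" where
  "irrational_unit = {0<..<1} - \<rat>"

lemma first_digit_pos:
  assumes "0 < t" "t \<le> 1"
  shows "first_digit t \<ge> 1"
proof -
  have "1 / t \<ge> 1" using assms by simp
  then have "\<lfloor>1 / t\<rfloor> \<ge> 1" by (simp add: le_floor_iff)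
  then have "nat 1 \<le> nat \<lfloor>1 / t\<rfloor>" by (rule nat_mono)
  then show ?thesis by (simp add: first_digit_def)
qed

lemma inverse_eq_first_digit_plus_gauss_map:
  assumes "0 < t"
  shows "1 / t = real (first_digit t) + gauss_map t"
proof -
  have "\<lfloor>1 / t\<rfloor> \<ge> 0" using assms by simp
  then show ?thesis by (simp add: first_digit_def gauss_map_def frac_def)
qed

lemma irrational_unit_first_digit:
  "x \<in> irrational_unit \<Longrightarrow> first_digit x \<ge> 1"
  using first_digit_pos[of x] by (simp add: irrational_unit_def)

lemma gauss_map_irrational_unit:
  assumes "x \<in> irrational_unit"
  shows "gauss_map x \<in> irrational_unit"
proof -
  have x: "0 < x" "x < 1" "x \<notin> \<rat>" using assms by (auto simp: irrational_unit_def)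
  have "1 / x \<notin> \<rat>"
  proof
    assume "1 / x \<in> \<rat>"
    then have "1 / (1 / x) \<in> \<rat>" by (rule Rats_divide[OF Rats_1])
    with x show False by simp
  qed
  then have nr: "gauss_map x \<notin> \<rat>"
    using inverse_eq_first_digit_plus_gauss_map[OF x(1)] by auto
  then have "gauss_map x \<noteq> 0" by auto
  then have "gauss_map x > 0" "gauss_map x < 1"
    unfolding gauss_map_def using frac_lt_1[of "1/x"] frac_ge_0[of "1/x"] by auto
  with nr show ?thesis by (auto simp: irrational_unit_def)
qed

lemma irrational_unit_eq:
  assumes "x \<in> irrational_unit"
  shows "x = 1 / (real (first_digit x) + gauss_map x)"
proof -
  have "x = 1 / (1 / x)" by simp
  also have "1 / x = real (first_digit x) + gauss_map x"
    using assms by (intro inverse_eq_first_digit_plus_gauss_map) (simp add: irrational_unit_def)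
  finally show ?thesis .
qed

lemma digit_pos: "x \<in> irrational_unit \<Longrightarrow> digit n x \<ge> 1"
  by (induction n arbitrary: x)
     (auto simp: digit_Suc gauss_map_irrational_unit dest: irrational_unit_first_digit)

lemma finite_cf_nonneg: "finite_cf as \<ge> 0"
  by (induction as) auto

lemma finite_cf_le_1:
  assumes "\<And>a. a \<in> set as \<Longrightarrow> a \<ge> 1"
  shows "finite_cf as \<le> 1"
proof (cases as)
  case (Cons b bs)
  then have "real b \<ge> 1" using assms[of b] by simp
  then show ?thesis using Cons finite_cf_nonneg[of bs] by (simp add: divide_simps)
qed simp

definition convergent_at :: "nat \<Rightarrow> real \<Rightarrow> real" where
  "convergent_at n x = finite_cf (map (\<lambda>i. digit i x) [0..<n])"

lemma convergent_at_0 [simp]: "convergent_at 0 x = 0"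
  by (simp add: convergent_at_def)

lemma convergent_at_Suc:
  "convergent_at (Suc n) x = 1 / (real (first_digit x) + convergent_at n (gauss_map x))"
  by (simp add: convergent_at_def upt_conv_Cons map_Suc_upt[symmetric] digit_Suc comp_def
      del: upt_Suc)

lemma convergent_at_bounds:
  assumes "x \<in> irrational_unit"
  shows "0 \<le> convergent_at n x" "convergent_at n x \<le> 1"
  using digit_pos[OF assms]
  by (auto simp: convergent_at_def finite_cf_nonneg intro!: finite_cf_le_1)

text \<open>Both sides of the difference have the form \<open>1 / (d + _)\<close> with the same first digit \<open>d\<close>, so
  the error at \<open>x\<close> is a multiple of the error at \<open>gauss_map x\<close>.\<close>

lemma convergent_at_Suc_error:
  assumes x: "x \<in> irrational_unit"
  shows "\<bar>convergent_at (Suc n) x - x\<bar> =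
    x * convergent_at (Suc n) x * \<bar>convergent_at n (gauss_map x) - gauss_map x\<bar>"
proof -
  define d where "d = real (first_digit x)"
  define y where "y = gauss_map x"
  define c where "c = convergent_at n y"
  have d: "d \<ge> 1" using irrational_unit_first_digit[OF x] by (simp add: d_def)
  have y: "y \<in> irrational_unit" using x by (simp add: y_def gauss_map_irrational_unit)
  have c: "c \<ge> 0" unfolding c_def using convergent_at_bounds[OF y] by blast
  have "y > 0" using y by (simp add: irrational_unit_def)
  have xe: "x = 1 / (d + y)" using irrational_unit_eq[OF x] by (simp add: d_def y_def)
  have ce: "convergent_at (Suc n) x = 1 / (d + c)"
    by (simp add: convergent_at_Suc d_def y_def c_def)
  have "1 / (d + c) - 1 / (d + y) = 1 / (d + y) * (1 / (d + c)) * (y - c)"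
    using d c \<open>y > 0\<close> by (simp add: field_simps)
  then have "\<bar>1 / (d + c) - 1 / (d + y)\<bar> = \<bar>1 / (d + y) * (1 / (d + c))\<bar> * \<bar>y - c\<bar>"
    by (simp only: abs_mult)
  also have "\<dots> = 1 / (d + y) * (1 / (d + c)) * \<bar>c - y\<bar>"
    using d c \<open>y > 0\<close> by (simp add: abs_minus_commute)
  finally show ?thesis
    unfolding ce y_def[symmetric] c_def[symmetric] using xe by simp
qed

text \<open>A single step of the expansion need not contract by a factor bounded away from \<open>1\<close>, since \<open>x\<close>
  may be close to \<open>1\<close>. Then \<open>gauss_map x\<close> is small, however: with \<open>d\<close> the first digit,
  \<open>x * gauss_map x = y / (d + y) \<le> 1/2\<close> for \<open>y = gauss_map x \<le> 1\<close>. So two steps halve the error.\<close>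

lemma convergent_at_error:
  "x \<in> irrational_unit \<Longrightarrow> \<bar>convergent_at n x - x\<bar> \<le> (1 / 2) ^ (n div 2)"
proof (induction n arbitrary: x rule: less_induct)
  case (less n)
  note x = less.prems
  show ?case
  proof (cases "n \<ge> 2")
    case False
    then have "n div 2 = 0" by simp
    moreover have "0 < x" "x < 1" using x by (auto simp: irrational_unit_def)
    ultimately show ?thesis using convergent_at_bounds[OF x, of n] by simp
  next
    case True
    then obtain m where n: "n = Suc (Suc m)" by (metis add_2_eq_Suc le_Suc_ex)
    define y where "y = gauss_map x"
    define z where "z = gauss_map y"
    have y: "y \<in> irrational_unit" using x by (simp add: y_def gauss_map_irrational_unit)
    have z: "z \<in> irrational_unit" using y by (simp add: z_def gauss_map_irrational_unit)
    have y01: "0 < y" "y < 1" using y by (auto simp: irrational_unit_def)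
    have x01: "0 < x" "x < 1" using x by (auto simp: irrational_unit_def)
    define d where "d = real (first_digit x)"
    have d: "d \<ge> 1" using irrational_unit_first_digit[OF x] by (simp add: d_def)
    have xe: "x = 1 / (d + y)" using irrational_unit_eq[OF x] by (simp add: d_def y_def)
    have "x * y = y / (d + y)" by (subst xe) simp
    also have "\<dots> \<le> 1 / 2" using d y01 by (simp add: field_simps)
    finally have xy: "x * y \<le> 1 / 2" .
    define c where "c = convergent_at (Suc (Suc m)) x * convergent_at (Suc m) y"
    have c: "0 \<le> c" "c \<le> 1"
      unfolding c_def using convergent_at_bounds[OF x] convergent_at_bounds[OF y]
      by (auto intro: mult_le_one)
    have IH: "\<bar>convergent_at m z - z\<bar> \<le> (1 / 2) ^ (m div 2)"
      using less.IH[OF _ z, of m] n by simp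
    have "\<bar>convergent_at n x - x\<bar> = (x * y) * c * \<bar>convergent_at m z - z\<bar>"
      unfolding n convergent_at_Suc_error[OF x] y_def[symmetric] convergent_at_Suc_error[OF y]
        z_def[symmetric] c_def by simp
    also have "\<dots> \<le> (1 / 2) * 1 * (1 / 2) ^ (m div 2)"
      using xy c IH x01 y01 by (intro mult_mono) auto
    also have "\<dots> = (1 / 2) ^ (n div 2)" by (simp add: n)
    finally show ?thesis .
  qed
qed

lemma convergent_at_LIMSEQ:
  assumes "x \<in> irrational_unit"
  shows "(\<lambda>n. convergent_at n x) \<longlonglongrightarrow> x"
proof -
  have "filterlim (\<lambda>n::nat. n div 2) sequentially sequentially"
    unfolding filterlim_at_top
  proof
    fix k :: nat
    show "\<forall>\<^sub>F n in sequentially. k \<le> n div 2"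
      using eventually_ge_at_top[of "2 * k"] by eventually_elim linarith
  qed
  then have "(\<lambda>n. (1 / 2 :: real) ^ (n div 2)) \<longlonglongrightarrow> 0"
    by (rule filterlim_compose[rotated]) (simp add: LIMSEQ_realpow_zero)
  then have "(\<lambda>n. convergent_at n x - x) \<longlonglongrightarrow> 0"
    by (rule Lim_null_comparison[rotated]) (simp add: convergent_at_error[OF assms])
  then show ?thesis by (simp add: LIM_zero_cancel)
qed

text \<open>A limit \<open>x\<close> of \<open>1 / (a 0 + c n)\<close> with \<open>c n \<in> [0,1]\<close> has
  \<open>1 / x - a 0 \<in> [0,1]\<close>, and irrationality excludes both endpoints, so \<open>a 0\<close> is the integer part of
  \<open>1 / x\<close> and the tails \<open>c n\<close> converge to \<open>gauss_map x\<close>.\<close>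

lemma expansion_first_step:
  assumes x: "x \<in> irrational_unit" and a: "\<And>i. a i \<ge> 1"
    and lim: "(\<lambda>n. finite_cf (map a [0..<n])) \<longlonglongrightarrow> x"
  shows "a 0 = first_digit x"
    and "(\<lambda>n. finite_cf (map (\<lambda>i. a (Suc i)) [0..<n])) \<longlonglongrightarrow> gauss_map x"
proof -
  have x01: "0 < x" "x < 1" "x \<notin> \<rat>" using x by (auto simp: irrational_unit_def)
  define c where "c = (\<lambda>n. finite_cf (map (\<lambda>i. a (Suc i)) [0..<n]))"
  have c: "0 \<le> c n" "c n \<le> 1" for n
    unfolding c_def using a by (auto simp: finite_cf_nonneg intro!: finite_cf_le_1)
  have "finite_cf (map a [0..<Suc n]) = 1 / (real (a 0) + c n)" for n
    by (simp add: c_def upt_conv_Cons map_Suc_upt[symmetric] comp_def del: upt_Suc)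
  with LIMSEQ_Suc[OF lim] have "(\<lambda>n. 1 / (real (a 0) + c n)) \<longlonglongrightarrow> x" by simp
  then have "(\<lambda>n. 1 / (1 / (real (a 0) + c n)) - real (a 0)) \<longlonglongrightarrow> 1 / x - real (a 0)"
    using x01 by (intro tendsto_intros) auto
  then have clim: "c \<longlonglongrightarrow> 1 / x - real (a 0)" by simp
  define y where "y = 1 / x - real (a 0)"
  have y: "0 \<le> y" "y \<le> 1"
    using LIMSEQ_le_const[OF clim, of 0] LIMSEQ_le_const2[OF clim, of 1] c
    by (auto simp: y_def)
  have "y \<noteq> 1"
  proof
    assume "y = 1"
    then have "x = 1 / (1 + real (a 0))" using x01 by (simp add: y_def field_simps)
    also have "\<dots> \<in> \<rat>" by (intro Rats_divide Rats_add) auto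
    finally show False using x01 by simp
  qed
  with y have "y < 1" by simp
  then have fl: "\<lfloor>1 / x\<rfloor> = int (a 0)"
    using y unfolding y_def by (intro floor_unique) auto
  then have "a 0 = first_digit x" by (simp add: first_digit_def)
  moreover have "y = gauss_map x" by (simp add: gauss_map_def frac_def fl y_def)
  ultimately show "a 0 = first_digit x" "(\<lambda>n. finite_cf (map (\<lambda>i. a (Suc i)) [0..<n])) \<longlonglongrightarrow> gauss_map x"
    using clim by (simp_all add: c_def y_def)
qed

lemma expansion_digits_unique:
  assumes "x \<in> irrational_unit" and "\<And>i. a i \<ge> 1"
    and "(\<lambda>n. finite_cf (map a [0..<n])) \<longlonglongrightarrow> x"
  shows "a n = digit n x"
  using assms
proof (induction n arbitrary: x a)
  case 0
  then show ?case using expansion_first_step(1)[of x a] by simp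
next
  case (Suc n)
  from Suc.IH[OF gauss_map_irrational_unit[OF Suc.prems(1)] _ expansion_first_step(2)[OF Suc.prems]]
  show ?case using Suc.prems(2) by (simp add: digit_Suc)
qed

lemma map_upt_1_Suc: "map a [1..<Suc n] = map (\<lambda>i. a (Suc i)) [0..<n]"
  by (simp add: map_Suc_upt[symmetric] comp_def del: upt_Suc)

lemma partial_quotient_eq_digit:
  assumes x: "x \<in> irrational_unit"
  shows "partial_quotient x (Suc n) = digit n x"
proof -
  define b where "b = (\<lambda>i. case i of 0 \<Rightarrow> 0 | Suc j \<Rightarrow> digit j x)"
  have "cf_expansion x b"
    unfolding cf_expansion_def map_upt_1_Suc
    using convergent_at_LIMSEQ[OF x] digit_pos[OF x]
    by (auto simp: b_def convergent_at_def Suc_le_eq split: nat.split)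
  moreover have "a = b" if "cf_expansion x a" for a
  proof
    fix i
    show "a i = b i"
    proof (cases i)
      case 0
      then show ?thesis using that by (simp add: cf_expansion_def b_def)
    next
      case (Suc j)
      have "a (Suc j) = digit j x"
        using that unfolding cf_expansion_def map_upt_1_Suc
        by (intro expansion_digits_unique[OF x, of "\<lambda>j. a (Suc j)"]) (auto simp: Suc_le_eq)
      then show ?thesis by (simp add: Suc b_def)
    qed
  qed
  ultimately have "partial_quotient x = b"
    unfolding partial_quotient_def by (rule the_equality)
  then show ?thesis by (simp add: b_def)
qed

section \<open>Moebius densities\<close>

text \<open>These are the laws of the tail of an expansion with prescribed beginning. The points whose
  expansion begins with \<open>a\<^sub>1, \<dots>, a\<^sub>n\<close> are \<open>(p\<^sub>n + t * p\<^sub>n\<^sub>-\<^sub>1) / (q\<^sub>n + t * q\<^sub>n\<^sub>-\<^sub>1)\<close>, where \<open>t\<close> is the \<open>n\<close>-th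
  iterate of the Gauss map and \<open>p\<^sub>n / q\<^sub>n\<close> the \<open>n\<close>-th convergent. Pulling normalised length back
  to \<open>t\<close> gives the density below with \<open>s = q\<^sub>n\<^sub>-\<^sub>1 / q\<^sub>n\<close>. Keeping only the parameter \<open>s\<close> avoids all computation with convergents.\<close>

definition moebius_density :: "real \<Rightarrow> real \<Rightarrow> real" where
  "moebius_density s t = (1 + s) / (1 + s * t)\<^sup>2"

definition moebius_measure :: "real \<Rightarrow> real measure" where
  "moebius_measure s =
     density lborel (\<lambda>t. ennreal (moebius_density s t) * indicator {0..1} t)"

lemma moebius_density_measurable [measurable]: "moebius_density s \<in> borel_measurable borel"
  unfolding moebius_density_def by measurable

lemma moebius_density_nonneg: "s \<ge> 0 \<Longrightarrow> moebius_density s t \<ge> 0"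
  by (simp add: moebius_density_def)

lemma sets_moebius_measure [simp, measurable_cong]: "sets (moebius_measure s) = sets borel"
  by (simp add: moebius_measure_def)

lemma space_moebius_measure [simp]: "space (moebius_measure s) = UNIV"
  by (simp add: moebius_measure_def)

lemma emeasure_moebius_measure:
  assumes "B \<in> sets borel"
  shows "emeasure (moebius_measure s) B =
    (\<integral>\<^sup>+t. ennreal (moebius_density s t) * indicator {0..1} t * indicator B t \<partial>lborel)"
  using assms unfolding moebius_measure_def by (intro emeasure_density) auto

lemma gauss_map_measurable [measurable]: "gauss_map \<in> borel_measurable borel"
  unfolding gauss_map_def frac_def by measurable

lemma first_digit_measurable [measurable]: "first_digit \<in> measurable borel (count_space UNIV)"
  unfolding first_digit_def by measurable

lemma gauss_map_funpow_measurable [measurable]: "gauss_map ^^ n \<in> borel_measurable borel"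
  by (induction n) (auto intro: measurable_comp gauss_map_measurable)

lemma digit_measurable [measurable]: "digit n \<in> measurable borel (count_space UNIV)"
  unfolding digit_def by measurable

lemma emeasure_moebius_measure_Icc_0:
  assumes s: "0 \<le> s" and b: "0 \<le> b" "b \<le> 1"
  shows "emeasure (moebius_measure s) {0..b} = ennreal ((1 + s) * b / (1 + s * b))"
proof -
  have "emeasure (moebius_measure s) {0..b} =
      (\<integral>\<^sup>+t. ennreal (moebius_density s t) * indicator {0..b} t \<partial>lborel)"
    unfolding emeasure_moebius_measure[OF atLeastAtMost_borel]
    using b by (intro nn_integral_cong) (auto split: split_indicator)
  also have "\<dots> = ennreal ((1 + s) * b / (1 + s * b) - (1 + s) * 0 / (1 + s * 0))"
  proof (intro nn_integral_FTC_Icc)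
    fix t assume t: "t \<in> {0..b}"
    then have "1 + s * t > 0" using s by (simp add: add_pos_nonneg)
    then show "((\<lambda>b. (1 + s) * b / (1 + s * b)) has_real_derivative moebius_density s t) (at t)"
      unfolding moebius_density_def
      by (auto intro!: derivative_eq_intros simp: field_simps power2_eq_square)
  qed (use s b in \<open>auto simp: moebius_density_nonneg\<close>)
  finally show ?thesis by simp
qed

lemma emeasure_moebius_measure_UNIV:
  assumes "0 \<le> s"
  shows "emeasure (moebius_measure s) UNIV = 1"
proof -
  have "emeasure (moebius_measure s) UNIV = emeasure (moebius_measure s) {0..1}"
    by (simp add: emeasure_moebius_measure indicator_inter_arith[symmetric] mult.assoc)
  also have "\<dots> = 1" using assms by (subst emeasure_moebius_measure_Icc_0) (auto simp: add_nonneg_eq_0_iff)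
  finally show ?thesis .
qed

lemma finite_moebius_measure: "0 \<le> s \<Longrightarrow> finite_measure (moebius_measure s)"
  by (intro finite_measureI) (simp add: emeasure_moebius_measure_UNIV)

lemma AE_moebius_measure: "(AE t in lborel. P t) \<Longrightarrow> AE t in moebius_measure s. P t"
  unfolding moebius_measure_def by (subst AE_density) auto

text \<open>The family is closed under the inverse branches \<open>u \<mapsto> 1 / (a + u)\<close> of the Gauss map: the factor
  in front is the probability of first digit \<open>a\<close>, and the parameter moves from \<open>s\<close> to \<open>1 / (a + s)\<close>,
  as \<open>q\<^sub>n\<^sub>-\<^sub>1 / q\<^sub>n\<close> does under the recursion \<open>q\<^sub>n\<^sub>+\<^sub>1 = a * q\<^sub>n + q\<^sub>n\<^sub>-\<^sub>1\<close>.\<close>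

lemma moebius_density_inverse_branch:
  assumes s: "0 \<le> s" and a: "a \<ge> 1" and u: "0 \<le> u" 
  shows "moebius_density s (1 / (a + u)) * (1 / (a + u)\<^sup>2) =
    (1 + s) / ((a + s) * (a + s + 1)) * moebius_density (1 / (a + s)) u"
proof -
  have "a + u > 0" "a + s > 0" "a + u + s > 0" using assms by auto
  have 1: "1 + s * (1 / (a + u)) = (a + u + s) / (a + u)"
    using \<open>a + u > 0\<close> by (simp add: field_simps)
  have 2: "1 + 1 / (a + s) * u = (a + u + s) / (a + s)"
       "1 + 1 / (a + s) = (a + s + 1) / (a + s)"
    using \<open>a + s > 0\<close> by (simp_all add: field_simps)
  show ?thesis unfolding moebius_density_def 1 2
    using \<open>a + u > 0\<close> \<open>a + s > 0\<close> \<open>a + u + s > 0\<close> by (simp add: divide_simps power2_eq_square)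
qed

text \<open>The Markov property of the digits, by substituting \<open>t = 1 / (a + u)\<close>.\<close>

lemma emeasure_first_digit_gauss_map:
  assumes s: "0 \<le> s" and a: "a \<ge> 1" and B [measurable]: "B \<in> sets borel"
  shows "emeasure (moebius_measure s) {t. first_digit t = a \<and> gauss_map t \<in> B} =
    ennreal ((1 + s) / ((real a + s) * (real a + s + 1))) * emeasure (moebius_measure (1 / (real a + s))) B"
proof -
  (* The substitution rule wants an increasing function, so the branch runs through 1 - u. The
     reflection is undone by the affine change of variables further below. *)
  define g where "g u = 1 / (real a + 1 - u)" for u :: real
  define f where "f t = ennreal (moebius_density s t) * indicator B (1 / t - real a)" for t
  have [measurable]: "f \<in> borel_measurable borel" unfolding f_def by measurable
  have "emeasure (moebius_measure s) {t. first_digit t = a \<and> gauss_map t \<in> B} =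
    (\<integral>\<^sup>+t. ennreal (moebius_density s t) * indicator {0..1} t *
        indicator {t. first_digit t = a \<and> gauss_map t \<in> B} t \<partial>lborel)"
    by (intro emeasure_moebius_measure) measurable
  also have "\<dots> = (\<integral>\<^sup>+t. f t * indicator {g 0..g 1} t \<partial>lborel)"
  proof (rule nn_integral_cong_AE)
    (* At the endpoints 1 / (a + 1) and 1 / a of the branch, digit and interval disagree. *)
    have "AE t in lborel. t \<noteq> g 0" "AE t in lborel. t \<noteq> g 1" "AE t in lborel. t \<noteq> (0::real)"
      by (rule AE_lborel_singleton)+
    then show "AE t in lborel. ennreal (moebius_density s t) * indicator {0..1} t *
        indicator {t. first_digit t = a \<and> gauss_map t \<in> B} t = f t * indicator {g 0..g 1} t"
    proof eventually_elim
      case (elim t)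
      show ?case
      proof (cases "t \<in> {g 0..g 1}")
        case True
        with elim have t: "1 / (real a + 1) < t" "t < 1 / real a" by (auto simp: g_def)
        then have "0 < t" by (rule_tac less_trans[of _ "1 / (real a + 1)"]) auto
        have "1 / real a \<le> 1" using a by simp
        with t have "t \<le> 1" by linarith
        have "real a < 1 / t" "1 / t < real a + 1"
          using t \<open>0 < t\<close> a by (auto simp: field_simps)
        then have "\<lfloor>1 / t\<rfloor> = int a" by (intro floor_unique) auto
        then show ?thesis using True \<open>0 < t\<close> \<open>t \<le> 1\<close>
          by (auto simp: f_def first_digit_def gauss_map_def frac_def split: split_indicator)
      next
        case False
        have "first_digit t \<noteq> a" if t: "t \<in> {0..1}"
        proof
          assume d: "first_digit t = a"
          have "0 < t" using t elim by auto
          then have e: "1 / t = real a + gauss_map t"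
            using inverse_eq_first_digit_plus_gauss_map[of t] d by simp
          have "0 \<le> gauss_map t" "gauss_map t < 1"
            by (auto simp: gauss_map_def frac_lt_1)
          with e have "real a \<le> 1 / t" "1 / t \<le> real a + 1" by auto
          then have "t \<in> {g 0..g 1}" using \<open>0 < t\<close> a by (auto simp: g_def field_simps)
          with False show False by simp
        qed
        with False show ?thesis by (auto split: split_indicator)
      qed
    qed
  qed
  also have "\<dots> = (\<integral>\<^sup>+u. f (g u) * ennreal (1 / (real a + 1 - u)\<^sup>2) * indicator {0..1} u \<partial>lborel)"
  proof (rule nn_integral_substitution_aux)
    fix u :: real assume u: "u \<in> {0..1}"
    then have "real a + 1 - u > 0" using a by auto
    then show "(g has_real_derivative 1 / (real a + 1 - u)\<^sup>2) (at u)"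
      unfolding g_def by (auto intro!: derivative_eq_intros simp: power2_eq_square)
  next
    show "continuous_on {0..1} (\<lambda>u. 1 / (real a + 1 - u)\<^sup>2)"
      using a by (intro continuous_intros) auto
  qed auto
  also have "\<dots> = (\<integral>\<^sup>+u. f (1 / (real a + u)) * ennreal (1 / (real a + u)\<^sup>2) * indicator {0..1} u \<partial>lborel)"
    unfolding g_def
    by (subst nn_integral_real_affine[where c = "-1" and t = 1])
       (auto intro!: nn_integral_cong split: split_indicator)
  also have "\<dots> = (\<integral>\<^sup>+u. ennreal ((1 + s) / ((real a + s) * (real a + s + 1))) *
      (ennreal (moebius_density (1 / (real a + s)) u) * indicator {0..1} u * indicator B u) \<partial>lborel)"
  proof (rule nn_integral_cong)
    fix u :: real
    show "f (1 / (real a + u)) * ennreal (1 / (real a + u)\<^sup>2) * indicator {0..1} u =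
      ennreal ((1 + s) / ((real a + s) * (real a + s + 1))) *
      (ennreal (moebius_density (1 / (real a + s)) u) * indicator {0..1} u * indicator B u)"
      using moebius_density_inverse_branch[of s "real a" u] s a
      by (auto simp: f_def ennreal_mult[symmetric] moebius_density_nonneg split: split_indicator)
  qed
  also have "\<dots> = ennreal ((1 + s) / ((real a + s) * (real a + s + 1))) *
      emeasure (moebius_measure (1 / (real a + s))) B"
    by (simp add: nn_integral_cmult emeasure_moebius_measure)
  finally show ?thesis .
qed

text \<open>Conditionally on each value of the first digit, \<open>gauss_map t\<close> has a law in the same family, so
  the uniform bound \<open>c\<close> applies to it. Its parameter \<open>1 / (a + s)\<close> is at most \<open>1\<close> because \<open>a \<ge> 1\<close>.
  For upper bounds, summing over the values in \<open>K\<close> makes the digits as good as independent.\<close>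

lemma emeasure_first_digit_gauss_map_le:
  assumes c: "\<And>s. 0 \<le> s \<Longrightarrow> s \<le> 1 \<Longrightarrow> emeasure (moebius_measure s) B \<le> c"
    and B [measurable]: "B \<in> sets borel" and s: "0 \<le> s"
  shows "emeasure (moebius_measure s) {t. first_digit t \<in> K \<and> gauss_map t \<in> B} \<le>
    emeasure (moebius_measure s) {t. first_digit t \<in> K} * c"
proof -
  define A where "A C a = {t. first_digit t = a \<and> a \<in> K \<and> gauss_map t \<in> C}" for C a
  have A: "emeasure (moebius_measure s) (\<Union>a. A C a) = (\<Sum>a. emeasure (moebius_measure s) (A C a))"
    if [measurable]: "C \<in> sets borel" for C
  proof (rule suminf_emeasure[symmetric])
    show "range (A C) \<subseteq> sets (moebius_measure s)" unfolding A_def by auto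
    show "disjoint_family (A C)" by (auto simp: disjoint_family_on_def A_def)
  qed
  have le: "emeasure (moebius_measure s) (A B a) \<le> emeasure (moebius_measure s) (A UNIV a) * c" for a
  proof (cases "a \<ge> 1 \<and> a \<in> K")
    case True
    let ?w = "ennreal ((1 + s) / ((real a + s) * (real a + s + 1)))"
    have "emeasure (moebius_measure s) (A B a) = ?w * emeasure (moebius_measure (1 / (real a + s))) B"
      using emeasure_first_digit_gauss_map[OF s, of a B] True by (simp add: A_def)
    also have "\<dots> \<le> ?w * c" using s True by (intro mult_left_mono c) auto
    also have "?w = emeasure (moebius_measure s) (A UNIV a)"
      using emeasure_first_digit_gauss_map[OF s, of a UNIV] True s
      by (simp add: A_def emeasure_moebius_measure_UNIV)
    finally show ?thesis .
  next
    case False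
    have "emeasure (moebius_measure s) (A B a) = 0"
    (* The digit 0 does not occur on the half-open interval from 0 to 1; at t = 0 it comes from
       1 / 0 = 0. *)
    proof (cases "a \<in> K")
      case True
      with False have "a = 0" by simp
      have "A B a \<in> sets borel" unfolding A_def by measurable
      moreover have "AE t in lborel. t \<noteq> (0::real)" by (rule AE_lborel_singleton)
      ultimately show ?thesis
        unfolding emeasure_moebius_measure[OF \<open>A B a \<in> sets borel\<close>]
      proof (subst nn_integral_0_iff_AE)
        assume "AE t in lborel. t \<noteq> (0::real)"
        then show "AE t in lborel. ennreal (moebius_density s t) * indicator {0..1} t * indicator (A B a) t = 0"
        proof eventually_elim
          case (elim t)
          have "t \<notin> A B a" if "t \<in> {0..1}"
            using first_digit_pos[of t] that elim \<open>a = 0\<close> by (auto simp: A_def)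
          then show ?case by (auto split: split_indicator)
        qed
      qed auto
    qed (simp add: A_def)
    then show ?thesis by simp
  qed
  have "{t. first_digit t \<in> K \<and> gauss_map t \<in> B} = (\<Union>a. A B a)" by (auto simp: A_def)
  then have "emeasure (moebius_measure s) {t. first_digit t \<in> K \<and> gauss_map t \<in> B} =
      (\<Sum>a. emeasure (moebius_measure s) (A B a))"
    using A[OF B] by simp
  also have "\<dots> \<le> (\<Sum>a. emeasure (moebius_measure s) (A UNIV a) * c)"
    by (intro suminf_le le) auto
  also have "\<dots> = emeasure (moebius_measure s) (\<Union>a. A UNIV a) * c"
    by (simp add: A)
  also have "(\<Union>a. A UNIV a) = {t. first_digit t \<in> K}" by (auto simp: A_def)
  finally show ?thesis .
qed

lemma emeasure_gauss_map_funpow_le: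
  assumes c: "\<And>s. 0 \<le> s \<Longrightarrow> s \<le> 1 \<Longrightarrow> emeasure (moebius_measure s) B \<le> c"
    and B [measurable]: "B \<in> sets borel" and "0 \<le> s" "s \<le> 1"
  shows "emeasure (moebius_measure s) {t. (gauss_map ^^ n) t \<in> B} \<le> c"
  using assms(3,4)
proof (induction n arbitrary: s)
  case 0
  then show ?case by (simp add: c)
next
  case (Suc n)
  let ?C = "{t. (gauss_map ^^ n) t \<in> B}"
  have "emeasure (moebius_measure s) {t. first_digit t \<in> UNIV \<and> gauss_map t \<in> ?C} \<le>
      emeasure (moebius_measure s) {t. first_digit t \<in> UNIV} * c"
    using Suc by (intro emeasure_first_digit_gauss_map_le) auto
  then show ?case
    using Suc.prems by (simp add: emeasure_moebius_measure_UNIV funpow_swap1)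
qed

section \<open>Large digits\<close>

lemma emeasure_first_digit_ge:
  assumes s: "0 \<le> s" and k: "k \<ge> 1"
  shows "emeasure (moebius_measure s) {t. k \<le> first_digit t} = ennreal ((1 + s) / (real k + s))"
proof -
  have "emeasure (moebius_measure s) {t. k \<le> first_digit t} =
      emeasure (moebius_measure s) {0..1 / real k}"
  proof (rule emeasure_eq_AE)
    have "AE t in moebius_measure s. t \<noteq> 0"
      by (intro AE_moebius_measure AE_lborel_singleton)
    then show "AE t in moebius_measure s. t \<in> {t. k \<le> first_digit t} \<longleftrightarrow> t \<in> {0..1 / real k}"
    proof eventually_elim
      case (elim t)
      have "k \<le> first_digit t \<longleftrightarrow> int k \<le> \<lfloor>1 / t\<rfloor>"
        using k unfolding first_digit_def by linarith
      then have *: "k \<le> first_digit t \<longleftrightarrow> real k \<le> 1 / t"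
        by (simp add: le_floor_iff)
      show ?case
      proof (cases "t > 0")
        case True
        then show ?thesis using k by (simp add: * field_simps)
      next
        case False
        then have "1 / t \<le> 0" by simp
        then have "\<not> real k \<le> 1 / t" using k by linarith
        then show ?thesis using False elim by (simp add: *)
      qed
    qed
  qed auto
  also have "\<dots> = ennreal ((1 + s) * (1 / real k) / (1 + s * (1 / real k)))"
    using s k by (intro emeasure_moebius_measure_Icc_0) auto
  also have "(1 + s) * (1 / real k) / (1 + s * (1 / real k)) = (1 + s) / (real k + s)"
  proof -
    have "1 + s * (1 / real k) = (real k + s) / real k" using k by (simp add: field_simps)
    then show ?thesis using k by simp
  qed
  finally show ?thesis .
qed

lemma emeasure_first_digit_le:
  assumes s: "0 \<le> s"
  shows "emeasure (moebius_measure s) {t. first_digit t \<le> m} \<le> ennreal (real m / real (Suc m))"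
proof -
  have "{t. first_digit t \<le> m} = space (moebius_measure s) - {t. Suc m \<le> first_digit t}"
    by auto
  also have "emeasure (moebius_measure s) \<dots> =
      emeasure (moebius_measure s) (space (moebius_measure s)) -
      emeasure (moebius_measure s) {t. Suc m \<le> first_digit t}"
    by (rule emeasure_compl) (use s in \<open>auto simp: emeasure_first_digit_ge\<close>)
  also have "\<dots> = ennreal (1 - (1 + s) / (real (Suc m) + s))"
    using s by (subst emeasure_first_digit_ge)
      (auto simp: emeasure_moebius_measure_UNIV ennreal_minus simp flip: ennreal_1)
  also have "1 - (1 + s) / (real (Suc m) + s) = real m / (real (Suc m) + s)"
    using s by (simp add: field_simps)
  also have "ennreal \<dots> \<le> ennreal (real m / real (Suc m))"
    using s by (intro ennreal_leI divide_left_mono) auto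
  finally show ?thesis .
qed

text \<open>The factor at position \<open>j\<close> is at most \<open>(m + j) / (m + j + 1)\<close>, and the product telescopes. The
  start \<open>m\<close> must vary in the induction, because dropping the first digit moves the diagonal up
  by one.\<close>

lemma emeasure_digits_below_diagonal:
  assumes "0 \<le> s" "s \<le> 1" "m \<ge> 1"
  shows "emeasure (moebius_measure s) {t. \<forall>j<N. digit j t \<le> m + j} \<le>
    ennreal (real m / real (m + N))"
  using assms
proof (induction N arbitrary: s m)
  case 0
  then show ?case by (simp add: emeasure_moebius_measure_UNIV)
next
  case (Suc N)
  let ?B = "{t. \<forall>j<N. digit j t \<le> Suc m + j}"
  have "{t. \<forall>j<Suc N. digit j t \<le> m + j} = {t. first_digit t \<in> {..m} \<and> gauss_map t \<in> ?B}"
    by (auto simp: All_less_Suc2 digit_Suc)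
  also have "emeasure (moebius_measure s) \<dots> \<le>
      emeasure (moebius_measure s) {t. first_digit t \<in> {..m}} *
      ennreal (real (Suc m) / real (Suc m + N))"
    using Suc.prems by (intro emeasure_first_digit_gauss_map_le Suc.IH) auto
  also have "\<dots> \<le> ennreal (real m / real (Suc m)) * ennreal (real (Suc m) / real (Suc m + N))"
    using Suc.prems emeasure_first_digit_le[of s m] by (intro mult_right_mono) auto
  also have "\<dots> = ennreal (real m / real (Suc m) * (real (Suc m) / real (Suc m + N)))"
    by (intro ennreal_mult[symmetric]) auto
  also have "real m / real (Suc m) * (real (Suc m) / real (Suc m + N)) = real m / real (m + Suc N)"
    by simp
  finally show ?case .
qed

lemma AE_infinitely_many_digits_large:
  "AE t in moebius_measure 0. \<exists>\<^sub>F n in sequentially. digit n t \<ge> Suc n"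
proof -
  have "AE t in moebius_measure 0. \<exists>i\<ge>n. digit i t \<ge> Suc i" if n: "n \<ge> 1" for n
  proof (rule AE_I)
    let ?E = "{t. \<forall>i\<ge>n. digit i t \<le> i}"
    have "emeasure (moebius_measure 0) ?E \<le> ennreal (real n / real (n + N))" for N
    proof -
      have "digit j ((gauss_map ^^ n) t) = digit (n + j) t" for j t
        by (simp add: digit_def add.commute[of n] funpow_add)
      then have "?E \<subseteq> {t. (gauss_map ^^ n) t \<in> {u. \<forall>j<N. digit j u \<le> n + j}}"
        by auto
      then have "emeasure (moebius_measure 0) ?E \<le>
          emeasure (moebius_measure 0) {t. (gauss_map ^^ n) t \<in> {u. \<forall>j<N. digit j u \<le> n + j}}"
        by (intro emeasure_mono) auto
      also have "\<dots> \<le> ennreal (real n / real (n + N))"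
        using n by (intro emeasure_gauss_map_funpow_le emeasure_digits_below_diagonal) auto
      finally show ?thesis .
    qed
    moreover have "(\<lambda>N. ennreal (real n / real (n + N))) \<longlonglongrightarrow> ennreal 0"
      by (intro tendsto_ennrealI) real_asymp
    ultimately have "emeasure (moebius_measure 0) ?E \<le> ennreal 0"
      by (intro LIMSEQ_le_const[of _ "ennreal 0"]) auto
    then show "emeasure (moebius_measure 0) ?E = 0" by simp
  next
    show "{t \<in> space (moebius_measure 0). \<not> (\<exists>i\<ge>n. digit i t \<ge> Suc i)} \<subseteq> {t. \<forall>i\<ge>n. digit i t \<le> i}"
      by (fastforce simp: not_less_eq_eq)
  qed measurable
  then have "AE t in moebius_measure 0. \<forall>n\<in>{1..}. \<exists>i\<ge>n. digit i t \<ge> Suc i"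
    by (subst AE_ball_countable) auto
  then show ?thesis
  proof eventually_elim
    case (elim t)
    have "\<exists>i\<ge>n. digit i t \<ge> Suc i" for n
      using bspec[OF elim, of "Suc n"] by (auto intro: Suc_leD)
    then show ?case by (auto simp: frequently_sequentially)
  qed
qed

lemma AE_eventually_digits_small:
  assumes p: "p > 1"
  shows "AE t in moebius_measure 0. \<forall>\<^sub>F n in sequentially. real (digit n t) < real (Suc n) powr p"
proof -
  interpret finite_measure "moebius_measure 0"
    by (rule finite_moebius_measure) simp
  (* The digit is an integer, so it reaches the real threshold iff it reaches its ceiling. *)
  define k where "k n = nat \<lceil>real (Suc n) powr p\<rceil>" for n
  define A where "A n = {t. real (Suc n) powr p \<le> real (digit n t)}" for n
  have k_iff: "k n \<le> d \<longleftrightarrow> real (Suc n) powr p \<le> real d" for n d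
    by (simp add: k_def nat_le_iff ceiling_le_iff)
  have k_ge: "real (Suc n) powr p \<le> real (k n)" for n
    using k_iff[of n "k n"] by simp
  have k1: "k n \<ge> 1" for n
  proof -
    have "0 < real (Suc n) powr p" by simp
    with k_ge[of n] have "0 < real (k n)" by linarith
    then show ?thesis by simp
  qed
  have A_sets [measurable]: "A n \<in> sets borel" for n unfolding A_def by measurable
  have A_le: "measure (moebius_measure 0) (A n) \<le> 2 * real (Suc n) powr (-p)" for n
  proof -
    have "A n = {t. (gauss_map ^^ n) t \<in> {u. k n \<le> first_digit u}}"
      by (simp add: A_def k_iff digit_def)
    also have "emeasure (moebius_measure 0) \<dots> \<le> ennreal (2 / real (k n))"
    proof (rule emeasure_gauss_map_funpow_le)
      fix s :: real assume s: "0 \<le> s" "s \<le> 1"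
      have "(1 + s) / (real (k n) + s) \<le> 2 / real (k n)"
        using s k1[of n] by (intro frac_le) auto
      then show "emeasure (moebius_measure s) {u. k n \<le> first_digit u} \<le> ennreal (2 / real (k n))"
        using s k1[of n] by (simp add: emeasure_first_digit_ge ennreal_leI)
    qed auto
    finally have "measure (moebius_measure 0) (A n) \<le> 2 / real (k n)"
      by (simp add: emeasure_eq_measure)
    also have "\<dots> \<le> 2 / real (Suc n) powr p"
      using k_ge[of n] k1[of n] by (intro divide_left_mono mult_pos_pos) auto
    finally show ?thesis by (simp add: powr_minus divide_inverse)
  qed
  have "summable (\<lambda>n. real n powr (-p))" using p by (simp add: summable_real_powr_iff)
  then have "summable (\<lambda>n. 2 * real (Suc n) powr (-p))"
    by (intro summable_mult) (subst summable_Suc_iff)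
  then have "summable (\<lambda>n. measure (moebius_measure 0) (A n))"
    by (rule summable_comparison_test'[where N = 0]) (use A_le in simp)
  then have "AE t in moebius_measure 0. \<forall>\<^sub>F n in sequentially. t \<in> space (moebius_measure 0) - A n"
    by (intro borel_cantelli_AE1) (auto simp: emeasure_eq_measure)
  then show ?thesis by (simp add: A_def not_le)
qed

lemma AE_lborel_if_AE_moebius_measure:
  assumes "AE t in moebius_measure 0. P t"
  shows "AE t in lborel. t \<in> {0<..<1} \<longrightarrow> P t"
  using assms unfolding moebius_measure_def
  by (subst (asm) AE_density) (auto simp: moebius_density_def elim!: eventually_mono)

section \<open>The upper limit\<close>

lemma limsup_ln_ratio_eq_1:
  fixes a :: "nat \<Rightarrow> nat"
  assumes pos: "\<And>n. a (Suc n) \<ge> 1"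
    and lower: "\<exists>\<^sub>F n in sequentially. a (Suc n) \<ge> Suc n"
    and upper: "\<And>m. \<forall>\<^sub>F n in sequentially. real (a (Suc n)) < real (Suc n) powr (1 + 1 / real (Suc m))"
  shows "limsup (\<lambda>n. ereal (ln (real (a n)) / ln (real n))) = 1"
proof (rule antisym)
  show "limsup (\<lambda>n. ereal (ln (real (a n)) / ln (real n))) \<le> 1"
  proof (rule ereal_le_epsilon2)
    fix e :: real assume "e > 0"
    then obtain m where m: "1 / real (Suc m) < e" using nat_approx_posE by blast
    have "\<forall>\<^sub>F n in sequentially. ereal (ln (real (a (Suc n))) / ln (real (Suc n))) \<le> 1 + ereal e"
      using upper[of m] eventually_ge_at_top[of 1]
    proof eventually_elim
      case (elim n)
      have "ln (real (a (Suc n))) \<le> ln (real (Suc n) powr (1 + 1 / real (Suc m)))"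
        using elim(1) pos[of n] by (intro ln_mono) auto
      also have "\<dots> = (1 + 1 / real (Suc m)) * ln (real (Suc n))" by (simp add: ln_powr)
      also have "\<dots> \<le> (1 + e) * ln (real (Suc n))"
        using m by (intro mult_right_mono) auto
      finally have "ln (real (a (Suc n))) / ln (real (Suc n)) \<le> 1 + e"
        using elim(2) by (simp add: pos_divide_le_eq)
      then show ?case by simp
    qed
    then have "\<forall>\<^sub>F n in sequentially. ereal (ln (real (a n)) / ln (real n)) \<le> 1 + ereal e"
      by (subst (asm) eventually_sequentially_Suc)
    then show "limsup (\<lambda>n. ereal (ln (real (a n)) / ln (real n))) \<le> 1 + ereal e"
      by (rule Limsup_bounded)
  qed
next
  have "\<exists>\<^sub>F n in sequentially. 1 \<le> ereal (ln (real (a n)) / ln (real n))"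
    unfolding frequently_sequentially
  proof
    fix N
    (* Suc N rather than N makes n positive, so that ln (Suc n) is not zero. *)
    obtain n where n: "n \<ge> Suc N" "a (Suc n) \<ge> Suc n"
      using lower by (auto simp: frequently_sequentially)
    then have "ln (real (Suc n)) \<le> ln (real (a (Suc n)))" by (intro ln_mono) auto
    moreover have "ln (real (Suc n)) > 0" using n by simp
    ultimately have "1 \<le> ln (real (a (Suc n))) / ln (real (Suc n))" by simp
    then show "\<exists>n\<ge>N. 1 \<le> ereal (ln (real (a n)) / ln (real n))"
      using n by (intro exI[of _ "Suc n"]) simp
  qed
  then have "\<not> (\<forall>\<^sub>F n in sequentially. ereal (ln (real (a n)) / ln (real n)) < 1)"
    by (simp add: frequently_def not_le)
  then show "1 \<le> limsup (\<lambda>n. ereal (ln (real (a n)) / ln (real n)))"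
    using Limsup_le_iff[of sequentially "\<lambda>n. ereal (ln (real (a n)) / ln (real n))"]
    by (meson linorder_not_le order_refl)
qed

lemma AE_irrational: "AE x in lborel. (x::real) \<notin> \<rat>"
  by (intro AE_I'[of \<rat>] countable_imp_null_set_lborel countable_rat) auto

theorem corollary2:
  "AE x in lebesgue_on {0<..<1::real}.
     limsup (\<lambda>n. ereal (ln (real (partial_quotient x n)) / ln (real n))) = 1"
proof -
  have "AE t in moebius_measure 0. \<forall>m. \<forall>\<^sub>F n in sequentially.
      real (digit n t) < real (Suc n) powr (1 + 1 / real (Suc m))"
    unfolding AE_all_countable by (intro allI AE_eventually_digits_small) simp
  from AE_lborel_if_AE_moebius_measure[OF this]
    AE_lborel_if_AE_moebius_measure[OF AE_infinitely_many_digits_large] AE_irrational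
  have "AE x in lborel. x \<in> {0<..<1} \<longrightarrow>
     limsup (\<lambda>n. ereal (ln (real (partial_quotient x n)) / ln (real n))) = 1"
  proof eventually_elim
    case (elim x)
    show ?case
    proof
      assume "x \<in> {0<..<1}"
      with elim have x: "x \<in> irrational_unit" by (simp add: irrational_unit_def)
      show "limsup (\<lambda>n. ereal (ln (real (partial_quotient x n)) / ln (real n))) = 1"
        using elim \<open>x \<in> {0<..<1}\<close> digit_pos[OF x]
        by (intro limsup_ln_ratio_eq_1) (auto simp: partial_quotient_eq_digit[OF x])
    qed
  qed
  then have "AE x in lebesgue. x \<in> {0<..<1} \<longrightarrow>
     limsup (\<lambda>n. ereal (ln (real (partial_quotient x n)) / ln (real n))) = 1"
    by (rule AE_completion)
  then show ?thesis by (subst AE_restrict_space_iff) auto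
qed

end
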